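(* Let $F$ be a finitely generated free group and $N$ a normal subgroup of $F$ of finite index. Then every subgroup of $F/N'$ (for example $F'/N'$) is crystallographic.
   Context: For a group $G$, $G'=[G,G]$ denotes its commutator subgroup. A crystallographic group is a group $G$ containing a normal subgroup $A$ of finite index which is free abelian of finite rank (rank $0$ allowed) and such that the centralizer $C_G(A)$ coincides with $A$. *)

theory Defs
  imports "HOL-Algebra.Generated_Groups" "HOL-Algebra.Free_Abelian_Groups"
begin

section \<open>Free groups\<close>

text \<open>
  The free group on \<open>X\<close> is the group of reduced words in the letters \<open>X \<times> UNIV\<close>: the letter
  \<open>(x, True)\<close> stands for the generator \<open>x\<close> and \<open>(x, False)\<close> for its inverse.
\<close>

type_synonym 'x letter = "'x \<times> bool"

definition inv_letter :: "'x letter \<Rightarrow> 'x letter" where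
  "inv_letter a = (fst a, \<not> snd a)"

definition reduced :: "'x letter list \<Rightarrow> bool" where
  "reduced w \<longleftrightarrow> successively (\<lambda>a b. b \<noteq> inv_letter a) w"

fun reduced_cons :: "'x letter \<Rightarrow> 'x letter list \<Rightarrow> 'x letter list" where
  "reduced_cons a [] = [a]"
| "reduced_cons a (b # w) = (if b = inv_letter a then w else a # b # w)"

text \<open>For reduced \<open>u\<close> and \<open>v\<close>, \<open>foldr reduced_cons u v\<close> is the reduced form of \<open>u @ v\<close>.\<close>

definition free_group :: "'x set \<Rightarrow> 'x letter list monoid" where
  "free_group X =
     \<lparr>carrier = {w. reduced w \<and> set w \<subseteq> X \<times> UNIV}, mult = foldr reduced_cons, one = []\<rparr>"

lemma inv_letter_inv_letter [simp]: "inv_letter (inv_letter a) = a"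
  by (simp add: inv_letter_def)

lemma reduced_Cons_Cons:
  "reduced (a # b # w) \<longleftrightarrow> b \<noteq> inv_letter a \<and> reduced (b # w)"
  by (simp add: reduced_def)

lemma reduced_Nil [simp]: "reduced []" and reduced_single [simp]: "reduced [a]"
  by (simp_all add: reduced_def)

lemma reduced_ConsD: "reduced (a # w) \<Longrightarrow> reduced w"
  by (cases w) (auto simp: reduced_Cons_Cons)

lemma reduced_reduced_cons: "reduced w \<Longrightarrow> reduced (reduced_cons a w)"
  by (cases w) (auto simp: reduced_Cons_Cons dest: reduced_ConsD)

lemma reduced_foldr: "reduced v \<Longrightarrow> reduced (foldr reduced_cons u v)"
  by (induction u) (auto intro: reduced_reduced_cons)

lemma set_reduced_cons: "set (reduced_cons a w) \<subseteq> insert a (set w)"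
  by (cases w) auto

lemma set_foldr_reduced_cons: "set (foldr reduced_cons u v) \<subseteq> set u \<union> set v"
  using set_reduced_cons by (induction u) fastforce+

lemma reduced_cons_reduced: "reduced (a # w) \<Longrightarrow> reduced_cons a w = a # w"
  by (cases w) (auto simp: reduced_Cons_Cons)

lemma reduced_cons_inverse:
  "reduced w \<Longrightarrow> reduced_cons a (reduced_cons (inv_letter a) w) = w"
  by (cases w) (auto simp: reduced_cons_reduced)

lemma foldr_reduced_cons_Nil: "reduced u \<Longrightarrow> foldr reduced_cons u [] = u"
proof (induction u)
  case (Cons a u)
  then have "foldr reduced_cons u [] = u"
    using reduced_ConsD by blast
  then show ?case using Cons.prems by (simp add: reduced_cons_reduced)
qed simp

lemma foldr_reduced_cons_step:
  assumes "reduced w"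
  shows "foldr reduced_cons (reduced_cons a u) w = reduced_cons a (foldr reduced_cons u w)"
  using assms by (cases u) (auto simp: reduced_cons_inverse reduced_foldr)

lemma foldr_reduced_cons_assoc:
  assumes "reduced w"
  shows "foldr reduced_cons (foldr reduced_cons u v) w
       = foldr reduced_cons u (foldr reduced_cons v w)"
  using assms by (induction u) (auto simp: foldr_reduced_cons_step)

lemma foldr_reduced_cons_left_inverse:
  assumes "reduced v"
  shows "foldr reduced_cons (rev (map inv_letter u)) (foldr reduced_cons u v) = v"
proof (induction u)
  case (Cons a u)
  have "reduced_cons (inv_letter a) (reduced_cons a (foldr reduced_cons u v))
      = foldr reduced_cons u v"
    using reduced_cons_inverse[of _ "inv_letter a"] reduced_foldr[OF assms] by simp
  then show ?case using Cons by simp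
qed (use assms in simp)

lemma group_free_group: "group (free_group X)"
proof (rule groupI, goal_cases)
  case (1 u v)
  then show ?case
    using set_foldr_reduced_cons[of u v] by (auto simp: free_group_def reduced_foldr)
next
  case (3 u v w)
  then show ?case by (simp add: free_group_def foldr_reduced_cons_assoc)
next
  case (5 u)
  let ?v = "foldr reduced_cons (rev (map inv_letter u)) []"
  have "?v \<otimes>\<^bsub>free_group X\<^esub> u = foldr reduced_cons (rev (map inv_letter u)) (foldr reduced_cons u [])"
    using 5 by (simp add: free_group_def foldr_reduced_cons_assoc foldr_reduced_cons_Nil)
  also have "\<dots> = \<one>\<^bsub>free_group X\<^esub>"
    by (simp only: foldr_reduced_cons_left_inverse reduced_Nil) (simp add: free_group_def)
  finally have "?v \<otimes>\<^bsub>free_group X\<^esub> u = \<one>\<^bsub>free_group X\<^esub>" .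
  moreover have "?v \<in> carrier (free_group X)"
    using 5 set_foldr_reduced_cons[of "rev (map inv_letter u)" "[]"]
    by (fastforce simp: free_group_def reduced_foldr inv_letter_def)
  ultimately show ?case by blast
qed (auto simp: free_group_def)

text \<open>
  A basis of a group \<open>F\<close> is in bijection with a subset of its carrier, so it is no restriction
  to take \<open>X\<close> to be a set of elements of the carrier type.
\<close>

definition is_free_group :: "('a, 'b) monoid_scheme \<Rightarrow> bool" where
  "is_free_group F \<longleftrightarrow> group F \<and> (\<exists>X :: 'a set. free_group X \<cong> F)"

definition finitely_generated_group :: "('a, 'b) monoid_scheme \<Rightarrow> bool" where
  "finitely_generated_group G \<longleftrightarrow>
     group G \<and> (\<exists>S. finite S \<and> S \<subseteq> carrier G \<and> generate G S = carrier G)"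


section \<open>Crystallographic groups\<close>

definition centralizer :: "('a, 'b) monoid_scheme \<Rightarrow> 'a set \<Rightarrow> 'a set" where
  "centralizer G A = {g \<in> carrier G. \<forall>a\<in>A. g \<otimes>\<^bsub>G\<^esub> a = a \<otimes>\<^bsub>G\<^esub> g}"

definition finite_index :: "('a, 'b) monoid_scheme \<Rightarrow> 'a set \<Rightarrow> bool" where
  "finite_index G H \<longleftrightarrow> finite (rcosets\<^bsub>G\<^esub> H)"

definition free_abelian_of_finite_rank :: "('a, 'b) monoid_scheme \<Rightarrow> bool" where
  "free_abelian_of_finite_rank G \<longleftrightarrow> (\<exists>n :: nat. free_Abelian_group {..<n} \<cong> G)"

definition crystallographic :: "('a, 'b) monoid_scheme \<Rightarrow> bool" where
  "crystallographic G \<longleftrightarrow>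
     group G \<and>
     (\<exists>A. A \<lhd> G \<and> finite_index G A \<and>
          free_abelian_of_finite_rank (G\<lparr>carrier := A\<rparr>) \<and>
          centralizer G A = A)"

end

theory Submission
  imports Defs "HOL-Algebra.Multiplicative_Group"
begin

text \<open>
  Let \<open>M\<close> be a subgroup of a free group on \<open>X\<close>. Reading a word along the Schreier coset graph of \<open>M\<close>
  and counting signed edge traversals is a homomorphism from \<open>M\<close> to the free abelian group on the
  edges. Its kernel is \<open>M'\<close>: for any transversal \<open>t\<close> with \<open>t M = 1\<close>, a word in \<open>M\<close> telescopes into a
  product of the elements \<open>t c x (t (c x))\<^sup>-\<^sup>1\<close>, one for each edge traversed, and modulo \<open>M'\<close> these
  commute. So \<open>M/M'\<close> is torsion-free, and \<open>N/N'\<close> embeds in a free abelian group of finite rank.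

  \<open>F/N'\<close> is torsion-free: if \<open>u\<^sup>n \<in> N'\<close>, let \<open>M\<close> be generated by \<open>N\<close> and \<open>u\<close>. Then
  \<open>u\<^sup>n \<in> M'\<close>, so \<open>u \<in> M'\<close>, and \<open>M' \<subseteq> N\<close> because \<open>M/N\<close> is cyclic; now \<open>u \<in> N\<close> and \<open>u \<in> N'\<close>.

  For \<open>H \<le> F/N'\<close> put \<open>B = H \<inter> N/N'\<close> and \<open>A = C_H(B)\<close>. As \<open>B\<close> is central of finite index in \<open>A\<close> and \<open>A\<close>
  is torsion-free, the transfer \<open>A \<rightarrow> B\<close> is injective, so \<open>A\<close> is free abelian of finite rank; and
  \<open>C_H(A) \<subseteq> C_H(B) = A\<close>.
\<close>

section \<open>Subgroups of free abelian groups\<close>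

lemma subgroup_free_Abelian_group_iff:
  "subgroup K (free_Abelian_group S) \<longleftrightarrow>
     0 \<in> K \<and> (\<forall>x\<in>K. Poly_Mapping.keys x \<subseteq> S) \<and> (\<forall>x\<in>K. \<forall>y\<in>K. x + y \<in> K) \<and> (\<forall>x\<in>K. - x \<in> K)"
proof
  assume K: "subgroup K (free_Abelian_group S)"
  then have sub: "\<forall>x\<in>K. Poly_Mapping.keys x \<subseteq> S"
    using subgroup.mem_carrier by fastforce
  then show "0 \<in> K \<and> (\<forall>x\<in>K. Poly_Mapping.keys x \<subseteq> S) \<and> (\<forall>x\<in>K. \<forall>y\<in>K. x + y \<in> K) \<and> (\<forall>x\<in>K. - x \<in> K)"
    using subgroup.one_closed[OF K] subgroup.m_closed[OF K] subgroup.m_inv_closed[OF K] by auto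
qed (auto simp: subgroup_def)

text \<open>Induction on \<open>S\<close>, splitting off one coordinate \<open>s\<close>. The
  elements of \<open>K\<close> with vanishing \<open>s\<close>-coordinate form a subgroup over the
  smaller set, and the \<open>s\<close>-coordinates of all of \<open>K\<close> form an ideal of the
  integers. If that ideal is nonzero, an element realizing its positive generator completes the
  basis.\<close>

lemma subgroup_free_Abelian_group_basis:
  assumes "finite S" "subgroup K (free_Abelian_group S)"
  shows "\<exists>T b. T \<subseteq> S \<and> bij_betw (frag_extend b) (carrier (free_Abelian_group T)) K"
  using assms
proof (induction S arbitrary: K rule: finite_induct)
  case empty
  then have "K = {0}"
    by (auto simp: subgroup_free_Abelian_group_iff)
  \<comment> \<open>Any \<open>b\<close> will do here: over the empty index set the only element is
    0.\<close>
  then have "bij_betw (frag_extend undefined) (carrier (free_Abelian_group {})) K"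
    by (auto simp: bij_betw_def inj_on_def image_iff)
  then show ?case by blast
next
  case (insert s S)
  note K = insert.prems[unfolded subgroup_free_Abelian_group_iff]
  have cmul: "frag_cmul q k \<in> K" if "k \<in> K" for q k
    using group.subgroup_int_pow_closed[OF group_free_Abelian_group insert.prems that, of q] K that by simp
  have diff: "x - y \<in> K" if "x \<in> K" "y \<in> K" for x y
    using K that by (metis diff_conv_add_uminus)
  have keysS: "Poly_Mapping.keys k \<subseteq> S" if "k \<in> K" "Poly_Mapping.lookup k s = 0" for k
    using K that by (metis in_keys_iff subset_insert)
  define K' where "K' = {k\<in>K. Poly_Mapping.lookup k s = 0}"
  have "subgroup K' (free_Abelian_group S)"
    using K keysS by (auto simp: subgroup_free_Abelian_group_iff K'_def lookup_add)
  then obtain T b where T: "T \<subseteq> S" and b: "bij_betw (frag_extend b) (carrier (free_Abelian_group T)) K'"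
    using insert.IH by blast
  show ?case
  proof (cases "K' = K")
    case True
    then show ?thesis using T b by blast
  next
    case False
    then obtain k where k: "k \<in> K" "Poly_Mapping.lookup k s \<noteq> 0"
      by (auto simp: K'_def)
    \<comment> \<open>The least \<open>n\<close> satisfying \<open>P\<close> is the positive
      generator \<open>d\<close> of the ideal of \<open>s\<close>-coordinates. Negating
      \<open>k\<close> if necessary shows that some positive coordinate occurs.\<close>
    define P where "P n \<longleftrightarrow> n > 0 \<and> (\<exists>k\<in>K. Poly_Mapping.lookup k s = int n)" for n
    have "\<exists>n. P n"
    proof (cases "Poly_Mapping.lookup k s > 0")
      case True
      then show ?thesis using k unfolding P_def by (metis zero_less_imp_eq_int)
    next
      case False
      then have "Poly_Mapping.lookup (- k) s > 0" "- k \<in> K"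
        using k K by auto
      then show ?thesis unfolding P_def by (metis zero_less_imp_eq_int)
    qed
    then have "P (LEAST n. P n)"
      by (rule LeastI_ex)
    moreover define d where "d = (LEAST n. P n)"
    ultimately obtain k0 where d: "d > 0" and k0: "k0 \<in> K" "Poly_Mapping.lookup k0 s = int d"
      unfolding P_def by blast
    \<comment> \<open>Division with remainder: subtracting a multiple of \<open>k0\<close> leaves an
      element of \<open>K\<close> whose \<open>s\<close>-coordinate is the remainder, so a nonzero
      remainder would contradict the minimality of \<open>d\<close>.\<close>
    have dvd: "Poly_Mapping.lookup x s mod int d = 0" if "x \<in> K" for x
    proof (rule ccontr)
      assume nz: "Poly_Mapping.lookup x s mod int d \<noteq> 0"
      let ?y = "x - frag_cmul (Poly_Mapping.lookup x s div int d) k0"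
      have "Poly_Mapping.lookup ?y s = Poly_Mapping.lookup x s mod int d"
        by (simp add: lookup_minus k0 minus_div_mult_eq_mod)
      moreover have "?y \<in> K" using that k0 cmul diff by blast
      moreover have pos: "Poly_Mapping.lookup x s mod int d > 0"
        using nz d pos_mod_sign[of "int d" "Poly_Mapping.lookup x s"] by linarith
      ultimately have "P (nat (Poly_Mapping.lookup x s mod int d))"
        unfolding P_def by auto
      then have "d \<le> nat (Poly_Mapping.lookup x s mod int d)"
        unfolding d_def by (rule Least_le)
      moreover have "Poly_Mapping.lookup x s mod int d < int d"
        using d by simp
      ultimately show False using pos by linarith
    qed
    \<comment> \<open>The index \<open>s\<close> does not lie in \<open>T\<close>, so it is free to
      label the new basis element \<open>k0\<close>.\<close>
    let ?b = "b(s := k0)"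
    have sT: "s \<notin> T" using T insert.hyps by blast
    \<comment> \<open>Separates the \<open>s\<close>-component of \<open>x\<close> from the rest, on
      which \<open>?b\<close> and \<open>b\<close> agree.\<close>
    have ext: "frag_extend ?b x = frag_extend b (x - frag_cmul (Poly_Mapping.lookup x s) (frag_of s)) + frag_cmul (Poly_Mapping.lookup x s) k0" for x
    proof -
      have "frag_extend ?b x = frag_extend ?b (x - frag_cmul (Poly_Mapping.lookup x s) (frag_of s)) + frag_extend ?b (frag_cmul (Poly_Mapping.lookup x s) (frag_of s))"
        by (simp flip: frag_extend_add)
      also have "frag_extend ?b (x - frag_cmul (Poly_Mapping.lookup x s) (frag_of s)) = frag_extend b (x - frag_cmul (Poly_Mapping.lookup x s) (frag_of s))"
        by (rule frag_extend_eq) (auto simp: in_keys_iff lookup_minus)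
      finally show ?thesis unfolding frag_extend_cmul frag_extend_of fun_upd_same .
    qed
    have keysT: "Poly_Mapping.keys (x - frag_cmul (Poly_Mapping.lookup x s) (frag_of s)) \<subseteq> T"
      if "Poly_Mapping.keys x \<subseteq> insert s T" for x
      using that by (auto simp: in_keys_iff lookup_minus split: if_splits)
    have in_K': "frag_extend b (x - frag_cmul (Poly_Mapping.lookup x s) (frag_of s)) \<in> K'"
      if "Poly_Mapping.keys x \<subseteq> insert s T" for x
      using bij_betwE[OF b] keysT[OF that] by simp
    have "bij_betw (frag_extend ?b) (carrier (free_Abelian_group (insert s T))) K"
      unfolding bij_betw_def
    proof
      \<comment> \<open>Elements of \<open>K'\<close> have \<open>s\<close>-coordinate 0, so the
        image of \<open>x\<close> has \<open>s\<close>-coordinate \<open>d\<close> times that of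
        \<open>x\<close>. Vanishing of the image thus removes \<open>s\<close> from
        \<open>x\<close>, and injectivity of \<open>b\<close> finishes.\<close>
      have *: "x = 0" if x: "Poly_Mapping.keys x \<subseteq> insert s T" and "frag_extend ?b x = 0" for x
      proof -
        have "Poly_Mapping.lookup (frag_extend ?b x) s = Poly_Mapping.lookup x s * int d"
          using in_K'[OF x] by (simp add: ext lookup_add k0 K'_def)
        then have 0: "Poly_Mapping.lookup x s = 0" using that d by simp
        then have "frag_extend b x = frag_extend b 0"
          using ext[of x] that by simp
        moreover have "Poly_Mapping.keys x \<subseteq> T" using keysT[OF x] 0 by simp
        ultimately show ?thesis
          using bij_betw_imp_inj_on[OF b] by (auto dest!: inj_onD[of _ _ x 0])
      qed
      have diff0: "x - y = 0"
        if "Poly_Mapping.keys x \<subseteq> insert s T" "Poly_Mapping.keys y \<subseteq> insert s T"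
          "frag_extend ?b x = frag_extend ?b y" for x y
      proof (rule *)
        show "Poly_Mapping.keys (x - y) \<subseteq> insert s T"
          using that keys_diff[of x y] by blast
      qed (simp only: frag_extend_diff that(3) diff_self)
      show "inj_on (frag_extend ?b) (carrier (free_Abelian_group (insert s T)))"
      proof (rule inj_onI)
        fix x y
        assume "x \<in> carrier (free_Abelian_group (insert s T))" "y \<in> carrier (free_Abelian_group (insert s T))"
          and "frag_extend ?b x = frag_extend ?b y"
        then have "x - y = 0"
          unfolding carrier_free_Abelian_group_iff by (rule diff0)
        then show "x = y" by simp
      qed
      show "frag_extend ?b ` carrier (free_Abelian_group (insert s T)) = K"
      proof
        show "frag_extend ?b ` carrier (free_Abelian_group (insert s T)) \<subseteq> K"
        proof clarify
          fix x assume "x \<in> carrier (free_Abelian_group (insert s T))"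
          then have "frag_extend b (x - frag_cmul (Poly_Mapping.lookup x s) (frag_of s)) \<in> K"
            using in_K' by (simp add: K'_def)
          then show "frag_extend ?b x \<in> K"
            unfolding ext using K cmul[OF k0(1)] by blast
        qed
        show "K \<subseteq> frag_extend ?b ` carrier (free_Abelian_group (insert s T))"
        proof
          fix x assume x: "x \<in> K"
          \<comment> \<open>Subtracting \<open>q\<close> copies of \<open>k0\<close> clears the
            \<open>s\<close>-coordinate of \<open>x\<close> exactly, by \<open>dvd\<close>, and
            moves \<open>x\<close> into \<open>K'\<close>, where \<open>b\<close> already supplies a
            preimage.\<close>
          define q where "q = Poly_Mapping.lookup x s div int d"
          have "x - frag_cmul q k0 \<in> K'"
            using x k0 cmul diff dvd[OF x]
            by (auto simp: K'_def lookup_minus q_def minus_div_mult_eq_mod)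
          then obtain y where y: "Poly_Mapping.keys y \<subseteq> T" "x - frag_cmul q k0 = frag_extend b y"
            using b unfolding bij_betw_def by (auto simp: image_iff)
          have "Poly_Mapping.lookup y s = 0" using y(1) sT by (meson in_keys_iff subsetD)
          then have "frag_extend ?b (y + frag_cmul q (frag_of s)) = x"
            using diff_add_cancel[of x "frag_cmul q k0"] y(2) unfolding ext by (simp add: lookup_add)
          moreover have "Poly_Mapping.keys (y + frag_cmul q (frag_of s)) \<subseteq> insert s T"
            using y(1) keys_add[of y "frag_cmul q (frag_of s)"] keys_cmul[of q "frag_of s"] by auto
          ultimately show "x \<in> frag_extend ?b ` carrier (free_Abelian_group (insert s T))"
            by (auto simp: image_iff)
        qed
      qed
    qed
    then show ?thesis using T by blast
  qed
qed

text \<open>The basis is indexed by a finite subset \<open>T\<close> of \<open>S\<close>; counting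
  \<open>T\<close> renames it to an initial segment of the naturals, as the definition of finite
  rank demands.\<close>

lemma subgroup_free_Abelian_group_free:
  assumes "finite S" "subgroup K (free_Abelian_group S)"
  shows "free_abelian_of_finite_rank ((free_Abelian_group S)\<lparr>carrier := K\<rparr>)"
proof -
  obtain T b where T: "T \<subseteq> S" and b: "bij_betw (frag_extend b) (carrier (free_Abelian_group T)) K"
    using subgroup_free_Abelian_group_basis[OF assms] by blast
  have "frag_extend b \<in> iso (free_Abelian_group T) ((free_Abelian_group S)\<lparr>carrier := K\<rparr>)"
    using b bij_betwE[OF b] by (auto simp: iso_def hom_def frag_extend_add)
  moreover have "free_Abelian_group {..<card T} \<cong> free_Abelian_group T"
    using T assms(1) finite_subset
    by (metis isomorphic_free_Abelian_groups eqpoll_iff_card card_lessThan finite_lessThan)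
  ultimately show ?thesis
    unfolding free_abelian_of_finite_rank_def using is_isoI iso_trans by blast
qed

lemma free_abelian_of_finite_rank_mon:
  assumes "group G" "finite S" "f \<in> mon G (free_Abelian_group S)"
  shows "free_abelian_of_finite_rank G"
proof -
  have f: "f \<in> hom G (free_Abelian_group S)" "inj_on f (carrier G)"
    using assms(3) by (auto simp: mon_def)
  interpret group_hom G "free_Abelian_group S" f
    using assms f by (simp add: group_hom_def group_hom_axioms_def)
  have "f \<in> iso G ((free_Abelian_group S)\<lparr>carrier := f ` carrier G\<rparr>)"
    using f by (auto simp: iso_def hom_def bij_betw_def)
  then have "(free_Abelian_group S)\<lparr>carrier := f ` carrier G\<rparr> \<cong> G"
    using assms(1) group.iso_sym is_isoI by blast
  then show ?thesis
    using subgroup_free_Abelian_group_free[OF assms(2) img_is_subgroup] iso_trans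
    unfolding free_abelian_of_finite_rank_def by blast
qed

section \<open>Abelianizations of subgroups of free groups\<close>

text \<open>
  \<open>(c, x)\<close> stands for the edge from \<open>c\<close> to \<open>c #> [(x, True)]\<close>; an inverse letter read at \<open>c\<close> traverses
  backwards the edge that ends at \<open>c\<close>.
\<close>

definition edge :: "'x set \<Rightarrow> 'x letter list set \<Rightarrow> 'x letter \<Rightarrow> ('x letter list set \<times> 'x) \<Rightarrow>\<^sub>0 int" where
  "edge X c a =
     (if snd a then frag_of (c, fst a) else - frag_of (c #>\<^bsub>free_group X\<^esub> [a], fst a))"

fun edge_count :: "'x set \<Rightarrow> 'x letter list set \<Rightarrow> 'x letter list \<Rightarrow> ('x letter list set \<times> 'x) \<Rightarrow>\<^sub>0 int" where
  "edge_count X c [] = 0"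
| "edge_count X c (a # w) = edge X c a + edge_count X (c #>\<^bsub>free_group X\<^esub> [a]) w"

section \<open>Signed edge counts of words in the Schreier coset graph\<close>

context
  fixes X :: "'x set" and F (structure)
  defines "F \<equiv> free_group X"
begin

interpretation group F
  unfolding F_def by (rule group_free_group)

lemma one_free_group: "\<one> = []"
  by (simp add: F_def free_group_def)

lemma letter_in_free_group: "[a] \<in> carrier F \<longleftrightarrow> fst a \<in> X"
  by (auto simp: F_def free_group_def mem_Times_iff)

lemma inv_letter_free_group: "fst a \<in> X \<Longrightarrow> inv [a] = [inv_letter a]"
  by (rule inv_equality) (auto simp: F_def free_group_def inv_letter_def mem_Times_iff)

lemma free_group_Cons:
  assumes "a # w \<in> carrier F"
  shows "fst a \<in> X" "w \<in> carrier F" "a # w = [a] \<otimes> w"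
  using assms reduced_ConsD by (auto simp: F_def free_group_def reduced_cons_reduced)

lemma rcoset_letter_inv:
  "c \<subseteq> carrier F \<Longrightarrow> fst a \<in> X \<Longrightarrow> c #> [a] #> [inv_letter a] = c"
  by (metis coset_mult_assoc coset_mult_one inv_letter_free_group letter_in_free_group inv_closed r_inv)

text \<open>A letter followed by its inverse traverses one edge forth and back, which contributes
  zero. Hence cancellation does not change the count.\<close>

lemma edge_count_reduced_cons:
  assumes "c \<subseteq> carrier F" "fst a \<in> X"
  shows "edge_count X c (reduced_cons a w) = edge_count X c (a # w)"
proof (cases w)
  case (Cons b w')
  show ?thesis
  proof (cases "b = inv_letter a")
    case True
    have "edge X c a + edge X (c #> [a]) (inv_letter a) = 0"
      using rcoset_letter_inv[OF assms] by (cases "a"; cases "snd a") (simp_all add: edge_def inv_letter_def flip: F_def)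
    moreover have "edge_count X c (a # w) =
        edge X c a + edge X (c #> [a]) (inv_letter a) + edge_count X (c #> [a] #> [inv_letter a]) w'"
      by (simp add: Cons True flip: F_def)
    ultimately show ?thesis
      using rcoset_letter_inv[OF assms] by (simp add: Cons True)
  qed (simp add: Cons)
qed simp

text \<open>The product prepends the letters of \<open>u\<close> to \<open>v\<close> one at a time,
  cancelling where possible, so the invariance under a single cancellation suffices. The start
  \<open>c\<close> varies in the induction because each letter moves to the next vertex.\<close>

lemma edge_count_mult:
  assumes "u \<in> carrier F" "v \<in> carrier F" "c \<subseteq> carrier F"
  shows "edge_count X c (u \<otimes> v) = edge_count X c u + edge_count X (c #> u) v"
  using assms(1,3)
proof (induction u arbitrary: c)
  case Nil
  show ?case
    using l_one[OF assms(2)] coset_mult_one[OF Nil.prems(2)] by (simp add: one_free_group)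
next
  case (Cons a u)
  note a = free_group_Cons[OF Cons.prems(1)]
  have la: "[a] \<in> carrier F" using a(1) letter_in_free_group by blast
  have ca: "c #> [a] \<subseteq> carrier F" "c #> (a # u) = c #> [a] #> u"
    using r_coset_subset_G[OF Cons.prems(2) la] coset_mult_assoc[OF Cons.prems(2) la a(2)] a(3) by simp_all
  have "(a # u) \<otimes> v = reduced_cons a (u \<otimes> v)"
    by (simp add: F_def free_group_def)
  then have "edge_count X c ((a # u) \<otimes> v) = edge_count X c (a # (u \<otimes> v))"
    using edge_count_reduced_cons[OF Cons.prems(2) a(1)] by simp
  also have "\<dots> = edge X c a + (edge_count X (c #> [a]) u + edge_count X (c #> [a] #> u) v)"
    using Cons.IH[OF a(2) ca(1)] by (simp flip: F_def)
  finally show ?case by (simp add: ca(2) flip: F_def)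
qed

lemma edge_count_closed:
  assumes "subgroup M F" "u \<in> carrier F" "c \<in> rcosets M"
  shows "Poly_Mapping.keys (edge_count X c u) \<subseteq> (rcosets M) \<times> X"
  using assms(2,3)
proof (induction u arbitrary: c)
  case (Cons a u)
  note a = free_group_Cons[OF Cons.prems(1)]
  have la: "[a] \<in> carrier F" using a(1) letter_in_free_group by blast
  obtain g where g: "g \<in> carrier F" "c = M #> g"
    using Cons.prems(2) by (auto simp: RCOSETS_def)
  then have "c #> [a] = M #> (g \<otimes> [a])"
    using la subgroup.subset[OF assms(1)] by (simp add: coset_mult_assoc)
  then have c: "c #> [a] \<in> rcosets M"
    using g la subgroup.subset[OF assms(1)] by (simp add: rcosetsI)
  have "Poly_Mapping.keys (edge X c a) \<subseteq> (rcosets M) \<times> X"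
    using c Cons.prems(2) a(1) by (auto simp: edge_def keys_minus simp flip: F_def)
  then show ?case
    using Cons.IH[OF a(2) c] keys_add[of "edge X c a" "edge_count X (c #> [a]) u"]
    by (auto simp flip: F_def)
qed simp

text \<open>A word \<open>u\<close> in \<open>M\<close> is a closed path at the vertex
  \<open>M\<close>, so the path of the second factor starts at \<open>M\<close> again and the counts
  add.\<close>

lemma edge_count_hom:
  assumes M: "subgroup M F"
  shows "edge_count X M \<in> hom (F\<lparr>carrier := M\<rparr>) (free_Abelian_group ((rcosets M) \<times> X))"
proof (rule homI)
  have "M \<in> rcosets M"
    using subgroup.subset[OF M] by (metis coset_mult_one one_closed rcosetsI)
  then show "edge_count X M u \<in> carrier (free_Abelian_group ((rcosets M) \<times> X))"
    if "u \<in> carrier (F\<lparr>carrier := M\<rparr>)" for u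
    using that edge_count_closed[OF M] subgroup.subset[OF M] by auto
  show "edge_count X M (u \<otimes>\<^bsub>F\<lparr>carrier := M\<rparr>\<^esub> v) =
      edge_count X M u \<otimes>\<^bsub>free_Abelian_group ((rcosets M) \<times> X)\<^esub> edge_count X M v"
    if "u \<in> carrier (F\<lparr>carrier := M\<rparr>)" "v \<in> carrier (F\<lparr>carrier := M\<rparr>)" for u v
    using that subsetD[OF subgroup.subset[OF M]] subgroup.subset[OF M] coset_join2[OF _ M, of u]
    by (simp add: edge_count_mult)
qed

text \<open>The projection of \<open>M\<close> to its abelianization is recovered from the edge
  count: it equals \<open>\<Psi>\<close> composed with \<open>edge_count X M\<close>, where
  \<open>\<Psi>\<close> sends each edge to the class of its Schreier generator.\<close>

lemma edge_count_kernel: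
  assumes M: "subgroup M F" and "u \<in> M" "edge_count X M u = 0"
  shows "u \<in> derived F M"
proof -
  note Msub = subgroup.subset[OF M]
  let ?D = "derived F M"
  let ?Q = "F\<lparr>carrier := M\<rparr> Mod ?D"
  interpret Q: comm_group ?Q
    by (rule derived_quot_of_subgroup_is_comm_group[OF M])
  interpret D: normal ?D "F\<lparr>carrier := M\<rparr>"
    by (rule derived_subgroup_is_normal[OF M])
  define q where "q g = ?D #> g" for g
  have q_mult: "q (g \<otimes> h) = q g \<otimes>\<^bsub>?Q\<^esub> q h" if "g \<in> M" "h \<in> M" for g h
    using D.rcos_sum[of g h] that by (simp add: q_def)
  have q_closed: "q g \<in> carrier ?Q" if "g \<in> M" for g
    using that by (auto simp: q_def carrier_FactGroup)
  have q_one: "q \<one> = \<one>\<^bsub>?Q\<^esub>"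
    using derived_in_carrier[OF Msub] by (simp add: q_def)
  \<comment> \<open>A transversal of the right cosets, normalized to be trivial on \<open>M\<close>.
    This normalization gives \<open>s M u = u\<close> at the end.\<close>
  define t where "t c = (if c = M then \<one> else SOME g. g \<in> c)" for c
  have t: "t c \<in> carrier F" "M #> t c = c" if c: "c \<in> rcosets M" for c
  proof -
    obtain g where g: "g \<in> carrier F" "c = M #> g"
      using c by (auto simp: RCOSETS_def)
    have "\<one> \<in> M" using subgroup.one_closed[OF M] .
    moreover have "(SOME g. g \<in> c) \<in> c"
      using rcos_self[OF g(1) M] g(2) by (auto intro: someI)
    ultimately have tc: "t c \<in> c"
      by (simp add: t_def)
    then show "t c \<in> carrier F"
      using g r_coset_subset_G[OF Msub g(1)] by blast
    show "M #> t c = c"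
      using tc g repr_independence[OF _ g(1) M, of "t c"] by simp
  qed
  have step: "c #> g \<in> rcosets M" if "c \<in> rcosets M" "g \<in> carrier F" for c g
    using t[OF that(1)] that Msub by (metis coset_mult_assoc m_closed rcosetsI)
  have rc_sub: "c \<subseteq> carrier F" if "c \<in> rcosets M" for c
    using that rcosets_subset_PowG[OF M] by blast
  \<comment> \<open>For a letter this is the Schreier generator of an edge; for a general
    \<open>g\<close> it is the telescoping product along the path of \<open>g\<close> from
    \<open>c\<close>, as \<open>s_mult\<close> shows.\<close>
  define s where "s c g = t c \<otimes> g \<otimes> inv (t (c #> g))" for c g
  have s_in: "s c g \<in> M" if "c \<in> rcosets M" "g \<in> carrier F" for c g
  proof -
    have "M #> (t c \<otimes> g) = M #> t (c #> g)"
      using t[OF that(1)] t[OF step[OF that]] that Msub by (simp flip: coset_mult_assoc)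
    then have "M #> (t c \<otimes> g \<otimes> inv (t (c #> g))) = M"
      using t(1)[OF that(1)] t(1)[OF step[OF that]] that Msub by (intro coset_mult_inv2) auto
    then show ?thesis
      using t(1)[OF that(1)] t(1)[OF step[OF that]] that M
      by (auto simp: s_def intro: coset_join1)
  qed
  have s_mult: "s c (g \<otimes> h) = s c g \<otimes> s (c #> g) h"
    if "c \<in> rcosets M" "g \<in> carrier F" "h \<in> carrier F" for c g h
  proof -
    let ?x = "t c" and ?y = "t (c #> g)" and ?z = "t (c #> g #> h)"
    have x: "?x \<in> carrier F" and y: "?y \<in> carrier F" and z: "?z \<in> carrier F"
      by (intro t(1) step that)+
    have "c #> (g \<otimes> h) = c #> g #> h"
      using that rc_sub by (simp add: coset_mult_assoc)
    then have "s c (g \<otimes> h) = ?x \<otimes> (g \<otimes> h) \<otimes> inv ?z"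
      by (simp add: s_def)
    also have "\<dots> = ?x \<otimes> g \<otimes> (inv ?y \<otimes> ?y) \<otimes> h \<otimes> inv ?z"
      using x y z that by (simp add: m_assoc)
    also have "\<dots> = (?x \<otimes> g \<otimes> inv ?y) \<otimes> (?y \<otimes> h \<otimes> inv ?z)"
      by (simp only: m_assoc m_closed inv_closed x y z that)
    finally show ?thesis by (simp add: s_def)
  qed
  \<comment> \<open>The universal property of the free abelian group applies because
    \<open>?Q\<close> is commutative.\<close>
  obtain \<Psi> where \<Psi>: "\<Psi> \<in> hom (free_Abelian_group ((rcosets M) \<times> X)) ?Q"
    and \<Psi>_of: "\<And>e. e \<in> (rcosets M) \<times> X \<Longrightarrow> \<Psi> (frag_of e) = q (s (fst e) [(snd e, True)])"
  proof (rule Q.free_Abelian_group_universal[of "\<lambda>e. q (s (fst e) [(snd e, True)])" "(rcosets M) \<times> X"])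
    show "(\<lambda>e. q (s (fst e) [(snd e, True)])) ` ((rcosets M) \<times> X) \<subseteq> carrier ?Q"
      using q_closed s_in letter_in_free_group by auto
  qed blast
  interpret \<Psi>: group_hom "free_Abelian_group ((rcosets M) \<times> X)" ?Q \<Psi>
    using \<Psi> Q.is_group by (simp add: group_hom_def group_hom_axioms_def)
  have \<Psi>_edge: "\<Psi> (edge X c a) = q (s c [a])" if c: "c \<in> rcosets M" and a: "fst a \<in> X" for c a
  proof (cases "snd a")
    case True
    then have "a = (fst a, True)" by (cases a) auto
    then show ?thesis using \<Psi>_of[of "(c, fst a)"] True c a by (auto simp: edge_def)
  next
    case False
    let ?c = "c #> [a]" and ?b = "inv_letter a"
    have b: "?b = (fst a, True)" using False by (simp add: inv_letter_def)
    have la: "[a] \<in> carrier F" and lb: "[?b] \<in> carrier F"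
      using a by (simp_all add: letter_in_free_group inv_letter_def)
    have c': "?c \<in> rcosets M" using step c la by blast
    have "?b # [] = inv [a]" using inv_letter_free_group[OF a] by simp
    \<comment> \<open>Reading \<open>a\<close> and then its inverse returns to \<open>c\<close>. So
      the value of a backward traversal is inverse to that of the forward edge, matching the sign in
      \<open>edge\<close>.\<close>
    then have "s c [a] \<otimes> s ?c [?b] = s c \<one>"
      using s_mult[OF c la lb] la by simp
    also have "\<dots> = \<one>" using t(1)[OF c] coset_mult_one[OF rc_sub[OF c]] by (simp add: s_def)
    finally have "q (s c [a]) \<otimes>\<^bsub>?Q\<^esub> q (s ?c [?b]) = \<one>\<^bsub>?Q\<^esub>"
      using q_mult[OF s_in[OF c la] s_in[OF c' lb]] q_one by simp
    then have "q (s c [a]) = inv\<^bsub>?Q\<^esub> q (s ?c [?b])"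
      using q_closed s_in c c' la lb by (metis Q.inv_equality)
    also have "\<dots> = inv\<^bsub>?Q\<^esub> \<Psi> (frag_of (?c, fst a))"
      using \<Psi>_of[of "(?c, fst a)"] c' a b by simp
    also have "\<dots> = \<Psi> (edge X c a)"
      using \<Psi>.hom_inv[of "frag_of (?c, fst a)"] c' a False by (simp add: edge_def flip: F_def)
    finally show ?thesis by simp
  qed
  \<comment> \<open>Stated for every starting coset, since the induction along the word changes it;
    only \<open>c = M\<close> is needed afterwards.\<close>
  have key: "\<Psi> (edge_count X c w) = q (s c w)" if "w \<in> carrier F" "c \<in> rcosets M" for w c
    using that
  proof (induction w arbitrary: c)
    case Nil
    have "s c \<one> = \<one>"
      using t(1)[of c] coset_mult_one[OF rc_sub[of c]] Nil by (simp add: s_def)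
    then show ?case
      using q_one \<Psi>.hom_one by (simp add: one_free_group)
  next
    case (Cons a w)
    note a = free_group_Cons[OF Cons.prems(1)]
    have la: "[a] \<in> carrier F" using a(1) letter_in_free_group by blast
    note c' = step[OF Cons.prems(2) la]
    have "Poly_Mapping.keys (edge X c a) \<subseteq> (rcosets M) \<times> X"
      using edge_count_closed[OF M la Cons.prems(2)] by simp
    then have "\<Psi> (edge_count X c (a # w)) = q (s c [a]) \<otimes>\<^bsub>?Q\<^esub> q (s (c #> [a]) w)"
      using \<Psi>.hom_mult[of "edge X c a" "edge_count X (c #> [a]) w"]
        edge_count_closed[OF M a(2) c'] \<Psi>_edge[OF Cons.prems(2) a(1)] Cons.IH[OF a(2) c']
      by (simp flip: F_def)
    also have "\<dots> = q (s c ([a] \<otimes> w))"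
      using s_mult[OF Cons.prems(2) la a(2)] q_mult s_in Cons.prems(2) c' la a(2) by simp
    finally show ?case using a(3) by simp
  qed
  have MM: "M \<in> rcosets M"
    using Msub by (metis coset_mult_one one_closed rcosetsI)
  have u: "u \<in> carrier F" using assms Msub by blast
  have "s M u = u"
    using u coset_join2[OF u M \<open>u \<in> M\<close>] by (simp add: s_def t_def)
  then have "q u = \<one>\<^bsub>?Q\<^esub>"
    using key[OF u MM] assms(3) \<Psi>.hom_one by simp
  then show ?thesis
    using coset_join1[OF _ u derived_is_subgroup[OF Msub]] by (simp add: q_def)
qed

end

section \<open>Finite generation and transport to abstract free groups\<close>

text \<open>Finitely many words involve only a finite set \<open>Y\<close> of generators. The
  reduced words over \<open>Y\<close> form a subgroup containing the generating set, hence
  everything, and the one-letter words then force \<open>X\<close> into \<open>Y\<close>.\<close>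

lemma finite_basis_if_finitely_generated:
  assumes "finitely_generated_group (free_group X)"
  shows "finite X"
proof -
  interpret group "free_group X" by (rule group_free_group)
  obtain S where S: "finite S" "S \<subseteq> carrier (free_group X)"
    "generate (free_group X) S = carrier (free_group X)"
    using assms by (auto simp: finitely_generated_group_def)
  define Y where "Y = fst ` \<Union>(set ` S)"
  have "Y \<subseteq> X"
    using S(2) by (fastforce simp: Y_def free_group_def)
  then have sub: "carrier (free_group Y) \<subseteq> carrier (free_group X)"
    by (auto simp: free_group_def)
  have "(free_group X)\<lparr>carrier := carrier (free_group Y)\<rparr> = free_group Y"
    by (simp add: free_group_def)
  then have "subgroup (carrier (free_group Y)) (free_group X)"
    using group_incl_imp_subgroup[OF sub] group_free_group[of Y] by simp
  moreover have "S \<subseteq> carrier (free_group Y)"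
  proof
    fix w assume w: "w \<in> S"
    then have "reduced w" using S(2) by (auto simp: free_group_def)
    moreover have "set w \<subseteq> Y \<times> UNIV"
      using w by (force simp: Y_def)
    ultimately show "w \<in> carrier (free_group Y)" by (simp add: free_group_def)
  qed
  ultimately have "carrier (free_group X) \<subseteq> carrier (free_group Y)"
    using generate_subgroup_incl S(3) by blast
  then have "X \<subseteq> Y"
    using letter_in_free_group[of "(_, True)"] by (metis fst_conv subset_iff)
  then show ?thesis
    using S(1) by (auto simp: Y_def intro: finite_subset)
qed

lemma finitely_generated_group_iso_img:
  assumes "finitely_generated_group G" "group H" "f \<in> iso G H"
  shows "finitely_generated_group H"
proof -
  obtain S where S: "finite S" "S \<subseteq> carrier G" "generate G S = carrier G" and G: "group G"
    using assms(1) by (auto simp: finitely_generated_group_def)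
  interpret group_hom G H f
    using assms G by (simp add: group_hom_def group_hom_axioms_def iso_def)
  have im: "f ` carrier G = carrier H"
    using assms(3) by (simp add: iso_def bij_betw_def)
  have "generate H (f ` S) = carrier H"
    using generate_img[OF S(2)] S(3) im by simp
  then show ?thesis
    using S im assms(2) unfolding finitely_generated_group_def by (metis finite_imageI image_mono)
qed

text \<open>Transports the edge count along an isomorphism \<open>k\<close> from \<open>F\<close> to
  a group of reduced words. The edge set \<open>E\<close> consists of pairs of a coset and a basis
  element, so finite index and a finite basis make it finite.\<close>

lemma abelianization_free_group_subgroup:
  fixes F :: "('a, 'b) monoid_scheme"
  assumes "is_free_group F" and M: "subgroup M F"
  shows "\<exists>(E :: ('a letter list set \<times> 'a) set) \<phi>.
    \<phi> \<in> hom (F\<lparr>carrier := M\<rparr>) (free_Abelian_group E) \<and>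
    (\<forall>u\<in>M. \<phi> u = 0 \<longrightarrow> u \<in> derived F M) \<and>
    (finitely_generated_group F \<longrightarrow> finite_index F M \<longrightarrow> finite E)"
proof -
  interpret F: group F using assms by (simp add: is_free_group_def)
  obtain X :: "'a set" and f where f: "f \<in> iso (free_group X) F"
    using assms by (auto simp: is_free_group_def is_iso_def)
  define k where "k = inv_into (carrier (free_group X)) f"
  have k: "k \<in> iso F (free_group X)"
    using group.iso_set_sym[OF group_free_group f] by (simp add: k_def)
  interpret k: group_hom F "free_group X" k
    using k by (simp add: group_hom_def group_hom_axioms_def iso_def group_free_group)
  have k_inj: "inj_on k (carrier F)" and k_img: "k ` carrier F = carrier (free_group X)"
    using k by (auto simp: iso_def bij_betw_def)
  note MF = subgroup.subset[OF M]
  let ?M = "k ` M"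
  have M': "subgroup ?M (free_group X)" by (rule k.subgroup_img_is_subgroup[OF M])
  let ?E = "(rcosets\<^bsub>free_group X\<^esub> ?M) \<times> X"
  let ?\<phi> = "edge_count X ?M \<circ> k"
  have "k \<in> hom (F\<lparr>carrier := M\<rparr>) ((free_group X)\<lparr>carrier := ?M\<rparr>)"
    using MF by (auto simp: hom_def subset_iff)
  then have "?\<phi> \<in> hom (F\<lparr>carrier := M\<rparr>) (free_Abelian_group ?E)"
    using edge_count_hom[OF M'] by (rule hom_compose)
  moreover have "u \<in> derived F M" if u: "u \<in> M" and "?\<phi> u = 0" for u
  proof -
    have "k u \<in> k ` derived F M"
      using edge_count_kernel[OF M', of "k u"] that k.derived_img[OF MF] by simp
    then show ?thesis
      using k_inj F.derived_in_carrier[OF MF] u MF by (metis inj_on_image_mem_iff subsetD)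
  qed
  moreover have "finite ?E" if "finitely_generated_group F" "finite_index F M"
  proof (rule finite_cartesian_product)
    have "?M #>\<^bsub>free_group X\<^esub> k g = k ` (M #>\<^bsub>F\<^esub> g)" if "g \<in> carrier F" for g
      using that MF by (force simp: r_coset_def subset_iff)
    then have "rcosets\<^bsub>free_group X\<^esub> ?M = image k ` (rcosets\<^bsub>F\<^esub> M)"
      unfolding RCOSETS_def k_img[symmetric] by auto
    then show "finite (rcosets\<^bsub>free_group X\<^esub> ?M)"
      using that(2) by (simp add: finite_index_def)
    show "finite X"
      using finitely_generated_group_iso_img[OF that(1) group_free_group k]
      by (rule finite_basis_if_finitely_generated)
  qed
  ultimately show ?thesis by blast
qed

section \<open>Roots of elements of derived subgroups\<close>

lemma (in group) derived_subset_kernel_to_comm_group: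
  assumes M: "subgroup M G" and \<phi>: "\<phi> \<in> hom (G\<lparr>carrier := M\<rparr>) H" and "comm_group H"
    and u: "u \<in> derived G M"
  shows "\<phi> u = \<one>\<^bsub>H\<^esub>"
proof -
  interpret H: comm_group H by fact
  interpret \<phi>: group_hom "G\<lparr>carrier := M\<rparr>" H \<phi>
    using \<phi> subgroup_imp_group[OF M] by (simp add: group_hom_def group_hom_axioms_def H.is_group)
  \<comment> \<open>Homomorphisms carry derived subgroups to derived subgroups;
    \<open>derived_consistent\<close> identifies the derived subgroup computed inside
    \<open>M\<close> with the one computed in \<open>G\<close>.\<close>
  have "\<phi> ` derived G M = derived H (\<phi> ` M)"
    using \<phi>.derived_img[of M] derived_consistent[OF _ M, of M] by simp
  also have "\<dots> = {\<one>\<^bsub>H\<^esub>}"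
    using \<phi>.hom_closed by (intro H.derived_eq_singleton) auto
  finally show ?thesis using u by blast
qed

text \<open>Under \<open>\<phi>\<close> the power becomes \<open>n\<close> times
  \<open>\<phi> u\<close>, and a free abelian group has no torsion.\<close>

lemma free_group_subgroup_derived_isolated:
  fixes F :: "('a, 'b) monoid_scheme"
  assumes "is_free_group F" and M: "subgroup M F"
    and u: "u \<in> M" and n: "n > 0" "u [^]\<^bsub>F\<^esub> (n::nat) \<in> derived F M"
  shows "u \<in> derived F M"
proof -
  interpret F: group F using assms by (simp add: is_free_group_def)
  obtain E :: "('a letter list set \<times> 'a) set" and \<phi> where \<phi>: "\<phi> \<in> hom (F\<lparr>carrier := M\<rparr>) (free_Abelian_group E)"
    and ker: "\<And>u. u \<in> M \<Longrightarrow> \<phi> u = 0 \<Longrightarrow> u \<in> derived F M"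
    using abelianization_free_group_subgroup[OF assms(1,2)] by metis
  interpret \<phi>: group_hom "F\<lparr>carrier := M\<rparr>" "free_Abelian_group E" \<phi>
    using \<phi> F.subgroup_imp_group[OF M] by (simp add: group_hom_def group_hom_axioms_def)
  have "u [^]\<^bsub>F\<lparr>carrier := M\<rparr>\<^esub> n = u [^]\<^bsub>F\<^esub> n"
    by (simp add: nat_pow_def)
  then have "frag_cmul (int n) (\<phi> u) = 0"
    using \<phi>.hom_nat_pow[of u n] u
      F.derived_subset_kernel_to_comm_group[OF M \<phi> abelian_free_Abelian_group n(2)] by simp
  then show ?thesis using ker u n(1) by simp
qed

lemma free_group_normal_derived_isolated:
  assumes F: "is_free_group F" and N: "N \<lhd> F"
    and u: "u \<in> carrier F" and n: "n > 0" "u [^]\<^bsub>F\<^esub> (n::nat) \<in> derived F N"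
  shows "u \<in> derived F N"
proof -
  interpret N: normal N F by (rule N)
  let ?Q = "F Mod N"
  interpret Q: group ?Q by (rule N.factorgroup_is_group)
  interpret \<pi>: group_hom F ?Q "\<lambda>x. N #>\<^bsub>F\<^esub> x"
    using N.r_coset_hom_Mod by (simp add: group_hom_def group_hom_axioms_def N.is_group Q.is_group)
  \<comment> \<open>The subgroup generated by \<open>N\<close> and \<open>u\<close>, written as the
    preimage of the cyclic group generated by the coset of \<open>u\<close>.\<close>
  define M where "M = {x \<in> carrier F. \<exists>i::int. N #>\<^bsub>F\<^esub> x = (N #>\<^bsub>F\<^esub> u) [^]\<^bsub>?Q\<^esub> i}"
  have uQ: "N #>\<^bsub>F\<^esub> u \<in> carrier ?Q" using u by simp
  have M: "subgroup M F"
  proof (rule N.subgroupI)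
    show "M \<noteq> {}"
      using \<pi>.hom_one by (auto simp: M_def intro!: exI[of _ "\<one>\<^bsub>F\<^esub>"] exI[of _ "0::int"])
  next
    fix x assume "x \<in> M"
    then obtain i :: int where x: "x \<in> carrier F" "N #>\<^bsub>F\<^esub> x = (N #>\<^bsub>F\<^esub> u) [^]\<^bsub>?Q\<^esub> i"
      by (auto simp: M_def)
    then have "N #>\<^bsub>F\<^esub> (inv\<^bsub>F\<^esub> x) = (N #>\<^bsub>F\<^esub> u) [^]\<^bsub>?Q\<^esub> (- i)"
      using \<pi>.hom_inv[of x] Q.int_pow_neg[OF uQ, of i] by simp
    then show "inv\<^bsub>F\<^esub> x \<in> M"
      using x(1) unfolding M_def by blast
  next
    fix x y assume "x \<in> M" "y \<in> M"
    then obtain i j :: int where xy: "x \<in> carrier F" "N #>\<^bsub>F\<^esub> x = (N #>\<^bsub>F\<^esub> u) [^]\<^bsub>?Q\<^esub> i"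
        "y \<in> carrier F" "N #>\<^bsub>F\<^esub> y = (N #>\<^bsub>F\<^esub> u) [^]\<^bsub>?Q\<^esub> j"
      by (auto simp: M_def)
    then have "N #>\<^bsub>F\<^esub> (x \<otimes>\<^bsub>F\<^esub> y) = (N #>\<^bsub>F\<^esub> u) [^]\<^bsub>?Q\<^esub> (i + j)"
      using \<pi>.hom_mult[of x y] Q.int_pow_mult[OF uQ, of i j] by simp
    then show "x \<otimes>\<^bsub>F\<^esub> y \<in> M"
      using xy unfolding M_def by blast
  qed (auto simp: M_def)
  have u_M: "u \<in> M"
    using u Q.int_pow_1[OF uQ] by (auto simp: M_def intro!: exI[of _ "1::int"])
  have N_M: "N \<subseteq> M"
    using N.rcos_const[OF N.is_group] N.subset by (auto simp: M_def intro!: exI[of _ "0::int"])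
  have "derived_set F M \<subseteq> N"
  proof clarify
    fix x y assume "x \<in> M" "y \<in> M"
    then obtain i j :: int where x: "x \<in> carrier F" "N #>\<^bsub>F\<^esub> x = (N #>\<^bsub>F\<^esub> u) [^]\<^bsub>?Q\<^esub> i"
        and y: "y \<in> carrier F" "N #>\<^bsub>F\<^esub> y = (N #>\<^bsub>F\<^esub> u) [^]\<^bsub>?Q\<^esub> j"
      by (auto simp: M_def)
    \<comment> \<open>Both cosets are powers of the coset of \<open>u\<close>, so they commute and
      the commutator of \<open>x\<close> and \<open>y\<close> falls into \<open>N\<close>.\<close>
    have "N #>\<^bsub>F\<^esub> (x \<otimes>\<^bsub>F\<^esub> y) = N #>\<^bsub>F\<^esub> (y \<otimes>\<^bsub>F\<^esub> x)"
      using \<pi>.hom_mult[OF x(1) y(1)] \<pi>.hom_mult[OF y(1) x(1)]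
        Q.int_pow_mult[OF uQ, of i j] Q.int_pow_mult[OF uQ, of j i] x(2) y(2)
      by (simp add: add.commute)
    then have "N #>\<^bsub>F\<^esub> (x \<otimes>\<^bsub>F\<^esub> y \<otimes>\<^bsub>F\<^esub> inv\<^bsub>F\<^esub> (y \<otimes>\<^bsub>F\<^esub> x)) = N"
      using x(1) y(1) N.subset by (intro N.coset_mult_inv2) auto
    from N.coset_join1[OF this _ N.subgroup_axioms]
    have "x \<otimes>\<^bsub>F\<^esub> y \<otimes>\<^bsub>F\<^esub> inv\<^bsub>F\<^esub> (y \<otimes>\<^bsub>F\<^esub> x) \<in> N"
      using x(1) y(1) by simp
    then show "x \<otimes>\<^bsub>F\<^esub> y \<otimes>\<^bsub>F\<^esub> inv\<^bsub>F\<^esub> x \<otimes>\<^bsub>F\<^esub> inv\<^bsub>F\<^esub> y \<in> N"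
      using x(1) y(1) by (simp add: N.inv_mult_group N.m_assoc)
  qed
  \<comment> \<open>Isolation is now applied twice: in \<open>M\<close> it puts \<open>u\<close>
    into the derived subgroup of \<open>M\<close>, hence into \<open>N\<close>; in \<open>N\<close>
    it then gives the claim.\<close>
  then have der: "derived F M \<subseteq> N"
    unfolding derived_def using N.generate_subgroup_incl N.subgroup_axioms by blast
  have "u \<in> derived F M"
    using free_group_subgroup_derived_isolated[OF F M u_M n(1)] n(2) N.mono_derived[OF N_M] by blast
  then show ?thesis
    using free_group_subgroup_derived_isolated[OF F N.subgroup_axioms _ n] der by blast
qed

section \<open>Torsion-free extensions of free abelian groups by finite groups\<close>

definition torsion_free :: "('a, 'b) monoid_scheme \<Rightarrow> bool" where
  "torsion_free G \<longleftrightarrow> (\<forall>x\<in>carrier G. \<forall>n>0::nat. x [^]\<^bsub>G\<^esub> n = \<one>\<^bsub>G\<^esub> \<longrightarrow> x = \<one>\<^bsub>G\<^esub>)"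

lemma sum_const_frag: "(\<Sum>i\<in>I. x) = frag_cmul (int (card I)) (x :: 'a \<Rightarrow>\<^sub>0 int)"
  by (induction I rule: infinite_finite_induct) (simp_all add: frag_cmul_distrib)

text \<open>\<open>V\<close> is the transfer into the kernel, composed with \<open>\<psi>\<close>; on the kernel it is \<open>\<bar>\<theta>(G)\<bar> \<psi>\<close>.\<close>

lemma transfer_mon:
  assumes hom: "group_hom G Q \<theta>" and fin: "finite (carrier Q)" and tf: "torsion_free G"
    and central: "\<And>z g. z \<in> kernel G Q \<theta> \<Longrightarrow> g \<in> carrier G \<Longrightarrow> g \<otimes>\<^bsub>G\<^esub> z = z \<otimes>\<^bsub>G\<^esub> g"
    and \<psi>: "\<psi> \<in> mon (G\<lparr>carrier := kernel G Q \<theta>\<rparr>) (free_Abelian_group E)"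
  shows "\<exists>V. V \<in> mon G (free_Abelian_group E)"
proof -
  interpret group_hom G Q \<theta> by (rule hom)
  \<comment> \<open>The map \<open>\<theta>\<close> may fail to be onto, so the cosets of the kernel
    are indexed by the image \<open>?R\<close> instead of \<open>carrier Q\<close>.\<close>
  let ?K = "kernel G Q \<theta>" and ?R = "\<theta> ` carrier G"
  have finR: "finite ?R" using fin by (rule finite_subset[rotated]) auto
  have \<psi>_mult: "\<psi> (a \<otimes>\<^bsub>G\<^esub> b) = \<psi> a + \<psi> b" if "a \<in> ?K" "b \<in> ?K" for a b
    using \<psi> that by (auto simp: mon_def hom_def)
  have \<psi>_closed: "Poly_Mapping.keys (\<psi> a) \<subseteq> E" if "a \<in> ?K" for a
    using \<psi> that by (fastforce simp: mon_def hom_def)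
  define s where "s r = (SOME g. g \<in> carrier G \<and> \<theta> g = r)" for r
  have s: "s r \<in> carrier G" "\<theta> (s r) = r" if "r \<in> ?R" for r
  proof -
    have "\<exists>g. g \<in> carrier G \<and> \<theta> g = r" using that by blast
    from someI_ex[OF this] show "s r \<in> carrier G" "\<theta> (s r) = r"
      unfolding s_def by blast+
  qed
  have R_mult: "r \<otimes>\<^bsub>Q\<^esub> \<theta> g \<in> ?R" if r: "r \<in> ?R" and g: "g \<in> carrier G" for r g
  proof -
    have "r \<otimes>\<^bsub>Q\<^esub> \<theta> g = \<theta> (s r \<otimes>\<^bsub>G\<^esub> g)" using s[OF r] g by simp
    then show ?thesis using s(1)[OF r] g by blast
  qed
  have R_sub: "r \<in> carrier Q" if "r \<in> ?R" for r using that by auto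
  \<comment> \<open>The factor of the transfer at the coset \<open>r\<close>: it compares
    \<open>s r\<close> times \<open>g\<close> with the chosen representative of its coset.\<close>
  define T where "T r g = s r \<otimes>\<^bsub>G\<^esub> g \<otimes>\<^bsub>G\<^esub> inv\<^bsub>G\<^esub> s (r \<otimes>\<^bsub>Q\<^esub> \<theta> g)" for r g
  have T_in: "T r g \<in> ?K" if "r \<in> ?R" "g \<in> carrier G" for r g
    using s[OF that(1)] s[OF R_mult[OF that]] that R_sub[OF that(1)]
    by (simp add: T_def kernel_def)
  have T_mult: "T r (g \<otimes>\<^bsub>G\<^esub> h) = T r g \<otimes>\<^bsub>G\<^esub> T (r \<otimes>\<^bsub>Q\<^esub> \<theta> g) h"
    if r: "r \<in> ?R" and g: "g \<in> carrier G" and h: "h \<in> carrier G" for r g h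
  proof -
    let ?x = "s r" and ?y = "s (r \<otimes>\<^bsub>Q\<^esub> \<theta> g)" and ?z = "s (r \<otimes>\<^bsub>Q\<^esub> \<theta> g \<otimes>\<^bsub>Q\<^esub> \<theta> h)"
    have x: "?x \<in> carrier G" and y: "?y \<in> carrier G" and z: "?z \<in> carrier G"
      by (intro s(1) R_mult r g h)+
    have "T r (g \<otimes>\<^bsub>G\<^esub> h) = ?x \<otimes>\<^bsub>G\<^esub> (g \<otimes>\<^bsub>G\<^esub> h) \<otimes>\<^bsub>G\<^esub> inv\<^bsub>G\<^esub> ?z"
      using R_sub[OF r] g h by (simp add: T_def H.m_assoc)
    also have "\<dots> = ?x \<otimes>\<^bsub>G\<^esub> g \<otimes>\<^bsub>G\<^esub> (inv\<^bsub>G\<^esub> ?y \<otimes>\<^bsub>G\<^esub> ?y) \<otimes>\<^bsub>G\<^esub> h \<otimes>\<^bsub>G\<^esub> inv\<^bsub>G\<^esub> ?z"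
      using x y z g h by (simp add: G.m_assoc)
    also have "\<dots> = (?x \<otimes>\<^bsub>G\<^esub> g \<otimes>\<^bsub>G\<^esub> inv\<^bsub>G\<^esub> ?y) \<otimes>\<^bsub>G\<^esub> (?y \<otimes>\<^bsub>G\<^esub> h \<otimes>\<^bsub>G\<^esub> inv\<^bsub>G\<^esub> ?z)"
      by (simp only: G.m_assoc G.m_closed G.inv_closed x y z g h)
    finally show ?thesis by (simp add: T_def)
  qed
  have T_central: "T r z = z" if r: "r \<in> ?R" and z: "z \<in> ?K" for r z
  proof -
    have zG: "z \<in> carrier G" and "\<theta> z = \<one>\<^bsub>Q\<^esub>" using z by (auto simp: kernel_def)
    then have "T r z = z \<otimes>\<^bsub>G\<^esub> s r \<otimes>\<^bsub>G\<^esub> inv\<^bsub>G\<^esub> s r"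
      using R_sub[OF r] central[OF z s(1)[OF r]] by (simp add: T_def)
    then show ?thesis using zG s(1)[OF r] by (simp add: G.m_assoc)
  qed
  define V where "V g = (\<Sum>r\<in>?R. \<psi> (T r g))" for g
  have V_mult: "V (g \<otimes>\<^bsub>G\<^esub> h) = V g + V h" if g: "g \<in> carrier G" and h: "h \<in> carrier G" for g h
  proof -
    \<comment> \<open>Right translation by \<open>\<theta> g\<close> is an injective self-map of the
      finite set \<open>?R\<close>, hence a permutation; this reindexes the second sum.\<close>
    have inj: "inj_on (\<lambda>r. r \<otimes>\<^bsub>Q\<^esub> \<theta> g) ?R"
      using R_sub g by (auto intro!: inj_onI)
    have "(\<lambda>r. r \<otimes>\<^bsub>Q\<^esub> \<theta> g) ` ?R = ?R"
      using R_mult g by (intro endo_inj_surj finR inj) blast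
    then have bij: "bij_betw (\<lambda>r. r \<otimes>\<^bsub>Q\<^esub> \<theta> g) ?R ?R"
      using inj by (simp add: bij_betw_def)
    have "V (g \<otimes>\<^bsub>G\<^esub> h) = (\<Sum>r\<in>?R. \<psi> (T r g) + \<psi> (T (r \<otimes>\<^bsub>Q\<^esub> \<theta> g) h))"
      unfolding V_def
    proof (rule sum.cong)
      fix r assume r: "r \<in> ?R"
      show "\<psi> (T r (g \<otimes>\<^bsub>G\<^esub> h)) = \<psi> (T r g) + \<psi> (T (r \<otimes>\<^bsub>Q\<^esub> \<theta> g) h)"
        unfolding T_mult[OF r g h] by (intro \<psi>_mult T_in R_mult r g h)
    qed simp
    also have "\<dots> = V g + (\<Sum>r\<in>?R. \<psi> (T (r \<otimes>\<^bsub>Q\<^esub> \<theta> g) h))"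
      by (simp add: V_def sum.distrib)
    also have "(\<Sum>r\<in>?R. \<psi> (T (r \<otimes>\<^bsub>Q\<^esub> \<theta> g) h)) = V h"
      unfolding V_def by (rule sum.reindex_bij_betw[OF bij])
    finally show ?thesis .
  qed
  have V_hom: "V \<in> hom G (free_Abelian_group E)"
  proof (rule homI)
    show "V g \<in> carrier (free_Abelian_group E)" if "g \<in> carrier G" for g
      unfolding V_def using \<psi>_closed T_in that by (intro sum_closed_free_Abelian_group) simp
  qed (simp add: V_mult)
  then interpret V: group_hom G "free_Abelian_group E" V
    by (simp add: group_hom_def group_hom_axioms_def)
  have "g = \<one>\<^bsub>G\<^esub>" if g: "g \<in> carrier G" and V0: "V g = 0" for g
  proof -
    \<comment> \<open>The power \<open>?h\<close> lies in the kernel, where \<open>V\<close> is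
      \<open>card ?R\<close> times \<open>\<psi>\<close>. Since \<open>V ?h\<close> is a multiple of
      \<open>V g = 0\<close>, \<open>\<psi> ?h\<close> vanishes, so \<open>?h\<close> is trivial and
      torsion-freeness gives the triviality of \<open>g\<close>.\<close>
    let ?h = "g [^]\<^bsub>G\<^esub> order Q"
    have pos: "order Q > 0" "card ?R > 0"
      using fin finR H.one_closed G.one_closed by (auto simp: order_def card_gt_0_iff)
    have K: "?h \<in> ?K"
      using g H.pow_order_eq_1[of "\<theta> g"] by (simp add: kernel_def hom_nat_pow)
    have "frag_cmul (int (card ?R)) (\<psi> ?h) = V ?h"
      using T_central[OF _ K] by (simp add: V_def sum_const_frag)
    also have "\<dots> = 0"
      using V.hom_nat_pow[OF g, of "order Q"] V0 by simp
    finally have "\<psi> ?h = 0" using pos by simp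
    moreover have "\<one>\<^bsub>G\<^esub> \<in> ?K" by (simp add: kernel_def)
    moreover from this have "\<psi> \<one>\<^bsub>G\<^esub> = 0"
      using \<psi>_mult[of "\<one>\<^bsub>G\<^esub>" "\<one>\<^bsub>G\<^esub>"] by simp
    ultimately have "?h = \<one>\<^bsub>G\<^esub>"
      using \<psi> K by (auto simp: mon_def inj_on_def)
    then show ?thesis using tf g pos(1) unfolding torsion_free_def by blast
  qed
  then have "V \<in> mon G (free_Abelian_group E)"
    using V_hom mon_iff_hom_one[OF G.is_group group_free_Abelian_group, of V] by auto
  then show ?thesis by blast
qed

section \<open>Centralizers and a criterion for being crystallographic\<close>

lemma (in group) centralizer_subgroup: "B \<subseteq> carrier G \<Longrightarrow> subgroup (centralizer G B) G"
proof (rule subgroupI)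
  assume B: "B \<subseteq> carrier G"
  show "centralizer G B \<noteq> {}"
    using B by (auto simp: centralizer_def intro!: exI[of _ \<one>])
  show "inv a \<in> centralizer G B" if "a \<in> centralizer G B" for a
  proof -
    have "inv a \<otimes> b = b \<otimes> inv a" if "b \<in> B" for b
      using that \<open>a \<in> centralizer G B\<close> B
      by (auto simp: centralizer_def intro!: inv_solve_left' [THEN iffD2])
         (metis inv_solve_right m_assoc m_closed inv_closed subsetD)
    then show ?thesis using that by (simp add: centralizer_def)
  qed
  show "a \<otimes> b \<in> centralizer G B" if "a \<in> centralizer G B" "b \<in> centralizer G B" for a b
    using that B by (auto simp: centralizer_def subset_iff) (metis m_assoc)
qed (auto simp: centralizer_def)

lemma (in group) centralizer_normal:
  assumes "B \<lhd> G"
  shows "centralizer G B \<lhd> G"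
proof (rule normal_invI)
  interpret B: normal B G by (rule assms)
  show "subgroup (centralizer G B) G" by (rule centralizer_subgroup[OF B.subset])
  fix a x assume a: "a \<in> centralizer G B" and x: "x \<in> carrier G"
  have aG: "a \<in> carrier G" using a by (simp add: centralizer_def)
  have cancel: "x \<otimes> (inv x \<otimes> y) = y" "inv x \<otimes> (x \<otimes> y) = y" if "y \<in> carrier G" for y
    using x that by (simp_all flip: m_assoc)
  have "x \<otimes> a \<otimes> inv x \<otimes> b = b \<otimes> (x \<otimes> a \<otimes> inv x)" if b: "b \<in> B" for b
  proof -
    have bG: "b \<in> carrier G" using b B.subset by blast
    \<comment> \<open>By normality \<open>c\<close> is again in \<open>B\<close>; conjugating the
      relation between \<open>a\<close> and \<open>c\<close> by \<open>x\<close> yields the one for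
      \<open>b\<close>.\<close>
    define c where "c = inv x \<otimes> b \<otimes> x"
    have c: "c \<in> B" "c \<in> carrier G" using B.inv_op_closed1[OF x b] B.subset by (auto simp: c_def)
    have b_eq: "b = x \<otimes> c \<otimes> inv x" using x bG by (simp add: c_def m_assoc cancel)
    have "x \<otimes> a \<otimes> inv x \<otimes> (x \<otimes> c \<otimes> inv x) = x \<otimes> (a \<otimes> c) \<otimes> inv x"
      using x aG c by (simp add: m_assoc cancel)
    also have "\<dots> = x \<otimes> (c \<otimes> a) \<otimes> inv x" using a c by (simp add: centralizer_def)
    also have "\<dots> = x \<otimes> c \<otimes> inv x \<otimes> (x \<otimes> a \<otimes> inv x)"
      using x aG c by (simp add: m_assoc cancel)
    finally show ?thesis by (simp flip: b_eq)
  qed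
  then show "x \<otimes> a \<otimes> inv x \<in> centralizer G B"
    using x aG by (simp add: centralizer_def)
qed

text \<open>The coset of \<open>g\<close> modulo \<open>A\<close> depends only on
  \<open>h g\<close>, so there are at most as many cosets as elements of \<open>H\<close>.\<close>

lemma (in group_hom) finite_index_if_kernel_subset:
  assumes A: "subgroup A G" "kernel G H h \<subseteq> A" and "finite (carrier H)"
  shows "finite_index G A"
proof -
  define c where "c q = A #> (SOME g. g \<in> carrier G \<and> h g = q)" for q
  have "A #> g = c (h g)" if g: "g \<in> carrier G" for g
  proof -
    let ?g = "SOME x. x \<in> carrier G \<and> h x = h g"
    have g': "?g \<in> carrier G" "h ?g = h g"
      using someI_ex[of "\<lambda>x. x \<in> carrier G \<and> h x = h g"] g by blast+
    then have "?g \<otimes> inv g \<in> A" using A(2) g by (auto simp: kernel_def)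
    then have "?g \<in> A #> g"
      using subgroup.rcos_module_rev[OF A(1) G.is_group g g'(1)] by blast
    then show ?thesis
      unfolding c_def by (rule G.repr_independence[OF _ g A(1)])
  qed
  then have "rcosets A \<subseteq> c ` carrier H"
    by (auto simp: RCOSETS_def)
  then show ?thesis
    unfolding finite_index_def using assms(3) finite_surj by blast
qed

text \<open>The kernel \<open>B\<close> is abelian but may be strictly smaller than its centralizer.
  Passing to that centralizer \<open>A\<close> keeps finite index, and the transfer shows that
  \<open>A\<close> is still free abelian of finite rank.\<close>

lemma crystallographic_if_finite_quotient:
  assumes hom: "group_hom G Q \<theta>" and fin: "finite (carrier Q)" and tf: "torsion_free G"
    and "finite E" and \<psi>: "\<psi> \<in> mon (G\<lparr>carrier := kernel G Q \<theta>\<rparr>) (free_Abelian_group E)"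
  shows "crystallographic G"
proof -
  interpret group_hom G Q \<theta> by (rule hom)
  define B where "B = kernel G Q \<theta>"
  define A where "A = centralizer G B"
  have BG: "B \<subseteq> carrier G" by (auto simp: B_def kernel_def)
  have comm: "a \<otimes>\<^bsub>G\<^esub> b = b \<otimes>\<^bsub>G\<^esub> a" if "a \<in> B" "b \<in> B" for a b
  proof -
    have "\<psi> (a \<otimes>\<^bsub>G\<^esub> b) = \<psi> (b \<otimes>\<^bsub>G\<^esub> a)"
      using \<psi> that by (auto simp: mon_def hom_def B_def add.commute)
    moreover have "a \<otimes>\<^bsub>G\<^esub> b \<in> B" "b \<otimes>\<^bsub>G\<^esub> a \<in> B"
      using that subgroup.m_closed[OF subgroup_kernel] by (auto simp: B_def)
    ultimately show ?thesis
      using \<psi> by (auto simp: mon_def inj_on_def B_def)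
  qed
  have BA: "B \<subseteq> A"
    using BG comm by (auto simp: A_def centralizer_def)
  have A_normal: "A \<lhd> G"
    unfolding A_def B_def by (rule G.centralizer_normal[OF normal_kernel])
  then have A: "subgroup A G" by (rule normal_imp_subgroup)
  note AG = subgroup.subset[OF A]
  have KA: "kernel (G\<lparr>carrier := A\<rparr>) Q \<theta> = B"
    using BA AG by (auto simp: kernel_def B_def)
  have pow: "x [^]\<^bsub>G\<lparr>carrier := A\<rparr>\<^esub> n = x [^]\<^bsub>G\<^esub> n" for x and n :: nat
    by (simp add: nat_pow_def)
  \<comment> \<open>The restriction of \<open>\<theta>\<close> to \<open>A\<close> still has kernel
    \<open>B\<close>, which is central in \<open>A\<close> by the choice of
    \<open>A\<close>.\<close>
  have "\<exists>V. V \<in> mon (G\<lparr>carrier := A\<rparr>) (free_Abelian_group E)"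
  proof (rule transfer_mon[OF induced_group_hom'[OF A] fin])
    show "torsion_free (G\<lparr>carrier := A\<rparr>)"
      using tf AG by (auto simp: torsion_free_def pow)
    show "\<psi> \<in> mon (G\<lparr>carrier := A, carrier := kernel (G\<lparr>carrier := A\<rparr>) Q \<theta>\<rparr>) (free_Abelian_group E)"
      using \<psi> by (simp add: KA flip: B_def)
    show "g \<otimes>\<^bsub>G\<lparr>carrier := A\<rparr>\<^esub> z = z \<otimes>\<^bsub>G\<lparr>carrier := A\<rparr>\<^esub> g"
      if "z \<in> kernel (G\<lparr>carrier := A\<rparr>) Q \<theta>" "g \<in> carrier (G\<lparr>carrier := A\<rparr>)" for z g
      using that unfolding KA by (simp add: A_def centralizer_def)
  qed
  then obtain V where V: "V \<in> mon (G\<lparr>carrier := A\<rparr>) (free_Abelian_group E)" by blast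
  have A_comm: "a \<otimes>\<^bsub>G\<^esub> b = b \<otimes>\<^bsub>G\<^esub> a" if "a \<in> A" "b \<in> A" for a b
  proof -
    have "V (a \<otimes>\<^bsub>G\<^esub> b) = V (b \<otimes>\<^bsub>G\<^esub> a)"
      using V that by (auto simp: mon_def hom_def add.commute)
    moreover have "a \<otimes>\<^bsub>G\<^esub> b \<in> A" "b \<otimes>\<^bsub>G\<^esub> a \<in> A"
      using that subgroup.m_closed[OF A] by auto
    ultimately show ?thesis
      using V by (auto simp: mon_def inj_on_def)
  qed
  have "centralizer G A = A"
  proof
    \<comment> \<open>Centralizers reverse inclusions, and \<open>B\<close> is contained in
      \<open>A\<close>.\<close>
    show "centralizer G A \<subseteq> A"
      using BA by (auto simp: A_def[of] centralizer_def)
    show "A \<subseteq> centralizer G A"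
      using A_comm AG by (auto simp: centralizer_def)
  qed
  moreover have "finite_index G A"
    using finite_index_if_kernel_subset[OF A _ fin] BA by (simp add: B_def)
  moreover have "free_abelian_of_finite_rank (G\<lparr>carrier := A\<rparr>)"
    using free_abelian_of_finite_rank_mon[OF G.subgroup_imp_group[OF A] \<open>finite E\<close> V] .
  ultimately show ?thesis
    unfolding crystallographic_def using A_normal G.is_group by blast
qed

text \<open>All hypotheses pass to \<open>H\<close>: restrict \<open>\<theta>\<close> to
  \<open>H\<close> and \<open>\<psi>\<close> to the smaller kernel, which is the intersection of
  \<open>H\<close> with the old one.\<close>

lemma crystallographic_subgroup_if_finite_quotient:
  assumes hom: "group_hom G Q \<theta>" and fin: "finite (carrier Q)" and tf: "torsion_free G"
    and E: "finite E" and \<psi>: "\<psi> \<in> mon (G\<lparr>carrier := kernel G Q \<theta>\<rparr>) (free_Abelian_group E)"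
    and H: "subgroup H G"
  shows "crystallographic (G\<lparr>carrier := H\<rparr>)"
proof -
  interpret group_hom G Q \<theta> by (rule hom)
  note HG = subgroup.subset[OF H]
  have pow: "x [^]\<^bsub>G\<lparr>carrier := H\<rparr>\<^esub> n = x [^]\<^bsub>G\<^esub> n" for x and n :: nat
    by (simp add: nat_pow_def)
  have sub: "kernel (G\<lparr>carrier := H\<rparr>) Q \<theta> \<subseteq> kernel G Q \<theta>"
    using HG by (auto simp: kernel_def)
  show ?thesis
  proof (rule crystallographic_if_finite_quotient[OF induced_group_hom'[OF H] fin _ E])
    show "torsion_free (G\<lparr>carrier := H\<rparr>)"
      using tf HG by (auto simp: torsion_free_def pow)
    show "\<psi> \<in> mon (G\<lparr>carrier := H, carrier := kernel (G\<lparr>carrier := H\<rparr>) Q \<theta>\<rparr>) (free_Abelian_group E)"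
      using \<psi> sub inj_on_subset[OF _ sub] by (auto simp: mon_def hom_def subset_iff)
  qed
qed

section \<open>The quotient of a free group by the derived subgroup of \<open>N\<close>\<close>

text \<open>Multiplication of cosets does not look at the carrier, so the two records agree. This
  views \<open>N/N'\<close> and \<open>F'/N'\<close> inside \<open>F/N'\<close>.\<close>

lemma FactGroup_restrict:
  "G\<lparr>carrier := H\<rparr> Mod D = (G Mod D)\<lparr>carrier := rcosets\<^bsub>G\<lparr>carrier := H\<rparr>\<^esub> D\<rparr>"
proof -
  have "set_mult (G\<lparr>carrier := H\<rparr>) = set_mult G"
    by (intro ext) simp
  then show ?thesis by (simp add: FactGroup_def)
qed

theorem proposition5p2:
  fixes F :: "('a, 'b) monoid_scheme" and N :: "'a set"
  assumes "is_free_group F"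
    and "finitely_generated_group F"
    and "N \<lhd> F"
    and "finite_index F N"
  shows "(\<forall>H. subgroup H (F Mod derived F N) \<longrightarrow>
              crystallographic ((F Mod derived F N)\<lparr>carrier := H\<rparr>)) \<and>
         crystallographic (F\<lparr>carrier := derived F (carrier F)\<rparr> Mod derived F N)"
proof -
  interpret N: normal N F by (rule assms(3))
  define D where "D = derived F N"
  let ?Q = "F Mod N" and ?G = "F Mod D" and ?FN = "F\<lparr>carrier := N\<rparr>"
  have D_normal: "D \<lhd> F"
    unfolding D_def by (rule N.derived_is_normal[OF assms(3)])
  interpret D: normal D F by (rule D_normal)
  interpret Q: group ?Q by (rule N.factorgroup_is_group)
  interpret G: group ?G by (rule D.factorgroup_is_group)
  interpret FN: group ?FN by (rule N.subgroup_imp_group[OF N.subgroup_axioms])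
  interpret \<pi>: group_hom F ?Q "\<lambda>x. N #>\<^bsub>F\<^esub> x"
    using N.r_coset_hom_Mod by (simp add: group_hom_def group_hom_axioms_def N.is_group Q.is_group)
  have DN: "D \<subseteq> N"
    unfolding D_def by (rule N.derived_incl[OF subset_refl N.subgroup_axioms])
  have coset_N: "N #>\<^bsub>F\<^esub> x = N \<longleftrightarrow> x \<in> N" and coset_D: "D #>\<^bsub>F\<^esub> x = D \<longleftrightarrow> x \<in> D"
    if "x \<in> carrier F" for x
    using N.coset_join1[OF _ that] N.coset_join2[OF that] N.subgroup_axioms D.subgroup_axioms by blast+
  have "D \<subseteq> kernel F ?Q (\<lambda>x. N #>\<^bsub>F\<^esub> x)"
    using DN N.subset coset_N by (auto simp: kernel_def)
  \<comment> \<open>The natural map from \<open>F/N'\<close> to \<open>F/N\<close>; its kernel is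
    \<open>N/N'\<close>.\<close>
  then obtain \<theta> where \<theta>: "\<theta> \<in> hom ?G ?Q"
    and \<theta>_coset: "\<And>x. x \<in> carrier F \<Longrightarrow> \<theta> (D #>\<^bsub>F\<^esub> x) = N #>\<^bsub>F\<^esub> x"
    using \<pi>.FactGroup_universal_kernel[OF D_normal] by blast
  have \<theta>_hom: "group_hom ?G ?Q \<theta>"
    using \<theta> G.is_group Q.is_group by (simp add: group_hom_def group_hom_axioms_def)
  have "kernel ?G ?Q \<theta> = (\<lambda>x. D #>\<^bsub>F\<^esub> x) ` N"
  proof (intro equalityI subsetI)
    fix X assume X: "X \<in> kernel ?G ?Q \<theta>"
    then obtain x where x: "x \<in> carrier F" "X = D #>\<^bsub>F\<^esub> x"
      by (auto simp: kernel_def carrier_FactGroup)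
    then have "N #>\<^bsub>F\<^esub> x = N"
      using X \<theta>_coset[OF x(1)] by (simp add: kernel_def)
    then show "X \<in> (\<lambda>x. D #>\<^bsub>F\<^esub> x) ` N"
      using x coset_N[OF x(1)] by blast
  next
    fix X assume "X \<in> (\<lambda>x. D #>\<^bsub>F\<^esub> x) ` N"
    then obtain x where x: "x \<in> N" "X = D #>\<^bsub>F\<^esub> x" by blast
    then have xF: "x \<in> carrier F" using N.subset by blast
    then show "X \<in> kernel ?G ?Q \<theta>"
      using x \<theta>_coset[OF xF] coset_N[OF xF] by (simp add: kernel_def carrier_FactGroup)
  qed
  moreover have "rcosets\<^bsub>?FN\<^esub> D = (\<lambda>x. D #>\<^bsub>F\<^esub> x) ` N"
    by (auto simp: RCOSETS_def)
  ultimately have kernel: "?G\<lparr>carrier := kernel ?G ?Q \<theta>\<rparr> = ?FN Mod D"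
    by (simp add: FactGroup_restrict)
  obtain E :: "('a letter list set \<times> 'a) set" and \<phi>
    where \<phi>: "\<phi> \<in> hom ?FN (free_Abelian_group E)"
      and \<phi>_inj: "\<And>u. u \<in> N \<Longrightarrow> \<phi> u = 0 \<Longrightarrow> u \<in> D"
      and E: "finite E"
    using abelianization_free_group_subgroup[OF assms(1) N.subgroup_axioms] assms(2,4)
    unfolding D_def by metis
  interpret \<phi>: group_hom ?FN "free_Abelian_group E" \<phi>
    using \<phi> by (simp add: group_hom_def group_hom_axioms_def)
  have DN_normal: "D \<lhd> ?FN"
    unfolding D_def by (rule N.derived_subgroup_is_normal[OF N.subgroup_axioms])
  have "D \<subseteq> kernel ?FN (free_Abelian_group E) \<phi>"
    using DN N.derived_subset_kernel_to_comm_group[OF N.subgroup_axioms \<phi> abelian_free_Abelian_group]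
    by (auto simp: kernel_def D_def)
  \<comment> \<open>The map that \<open>\<phi>\<close> induces on \<open>N/N'\<close>; it is
    injective because the kernel of \<open>\<phi>\<close> lies in \<open>D\<close>.\<close>
  then obtain \<psi> where \<psi>: "\<psi> \<in> hom (?FN Mod D) (free_Abelian_group E)"
    and \<psi>_coset: "\<And>x. x \<in> N \<Longrightarrow> \<psi> (D #>\<^bsub>F\<^esub> x) = \<phi> x"
    using \<phi>.FactGroup_universal_kernel[OF DN_normal] by auto
  have "X = D" if X: "X \<in> carrier (?FN Mod D)" and "\<psi> X = 0" for X
  proof -
    obtain x where x: "x \<in> N" "X = D #>\<^bsub>F\<^esub> x"
      using X by (auto simp: carrier_FactGroup)
    then have "x \<in> D"
      using \<phi>_inj[OF x(1)] \<psi>_coset[OF x(1)] that(2) by simp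
    then show ?thesis
      using x coset_D[of x] D.subset by blast
  qed
  then have \<psi>_mon: "\<psi> \<in> mon (?G\<lparr>carrier := kernel ?G ?Q \<theta>\<rparr>) (free_Abelian_group E)"
    using \<psi> mon_iff_hom_one[OF normal.factorgroup_is_group[OF DN_normal] group_free_Abelian_group, of \<psi>]
    unfolding kernel by auto
  have tf: "torsion_free ?G"
    unfolding torsion_free_def
  proof (intro ballI allI impI)
    fix X and n :: nat
    assume X: "X \<in> carrier ?G" and n: "n > 0" and pow: "X [^]\<^bsub>?G\<^esub> n = \<one>\<^bsub>?G\<^esub>"
    obtain x where x: "x \<in> carrier F" "X = D #>\<^bsub>F\<^esub> x"
      using X by (auto simp: carrier_FactGroup)
    \<comment> \<open>Torsion in the quotient means a root of an element of \<open>D\<close>, and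
      such roots already lie in \<open>D\<close>.\<close>
    then have "x [^]\<^bsub>F\<^esub> n \<in> D"
      using pow coset_D[of "x [^]\<^bsub>F\<^esub> n"] by (simp add: D.FactGroup_pow)
    then have "x \<in> D"
      unfolding D_def by (rule free_group_normal_derived_isolated[OF assms(1,3) x(1) n])
    then show "X = \<one>\<^bsub>?G\<^esub>"
      using x coset_D by simp
  qed
  have fin: "finite (carrier ?Q)"
    using assms(4) by (simp add: finite_index_def FactGroup_def)
  have all: "crystallographic (?G\<lparr>carrier := H\<rparr>)" if "subgroup H ?G" for H
    using crystallographic_subgroup_if_finite_quotient[OF \<theta>_hom fin tf E \<psi>_mon that] .
  let ?F' = "derived F (carrier F)"
  \<comment> \<open>Monotonicity of derived subgroups puts \<open>D\<close> inside
    \<open>?F'\<close>, so the cosets of \<open>D\<close> in \<open>?F'\<close> form a subgroup of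
    \<open>?G\<close>.\<close>
  have "subgroup (rcosets\<^bsub>F\<lparr>carrier := ?F'\<rparr>\<^esub> D) ?G"
    using N.normal_subgroup_factorize[OF D_normal _ N.derived_is_subgroup[OF subset_refl]]
      N.mono_derived[OF N.subset] by (simp add: D_def)
  moreover have "F\<lparr>carrier := ?F'\<rparr> Mod D = ?G\<lparr>carrier := rcosets\<^bsub>F\<lparr>carrier := ?F'\<rparr>\<^esub> D\<rparr>"
    by (rule FactGroup_restrict)
  ultimately have "crystallographic (F\<lparr>carrier := ?F'\<rparr> Mod D)"
    using all by metis
  then show ?thesis
    using all unfolding D_def by blast
qed

end
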